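(* Let $Q(x_1,x_2,x_3,x_4)$ be a quadratic form, with rational coefficients, in four independent variables $x_1,x_2,x_3,x_4$, let $A$ be the matrix of $Q$, and suppose that the diophantine equation $$Q(x_1,x_2,x_3,x_4)=0$$ has a nontrivial solution in integers. Then the complete solution of $Q(x_1,x_2,x_3,x_4)=0$ can be expressed in terms of bilinear forms in four parameters if and only if the determinant $|A|$ is a nonzero perfect square.
   Context: The matrix of a quadratic form $Q$ in $x=(x_1,\dots,x_4)^{T}$ is the symmetric matrix $A$ with $Q(x)=x^{T}Ax$. A form is said to be in four independent variables if it cannot be transformed, by an invertible rational linear change of variables, into a form in fewer than four variables (equivalently, $|A|\neq 0$). A rational number is a perfect square if it is the square of a rational number. A solution is nontrivial if it is not $(0,0,0,0)$. The equation is homogeneous; solutions differing by a nonzero rational factor are considered equivalent and treated as a single solution. The complete solution is expressed in terms of bilinear forms in four parameters if there are four bilinear forms $B_i$ $(i=1,\dots,4)$ with rational coefficients in the pairs of parameters $(p,q)$ and $(r,s)$ (each $B_i$ is a rational linear combination of $pr,ps,qr,qs$) such that $x_i=B_i(p,q;r,s)$ is a solution of the equation for all rational $p,q,r,s$, and every rational solution of the equation is obtained in this way, up to a nonzero rational factor, from some rational $p,q,r,s$. *)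

theory Defs
  imports "HOL-Analysis.Analysis" "HOL-Computational_Algebra.Nth_Powers"
begin

definition quadratic_form :: "(rat ^ 'n \<Rightarrow> rat) \<Rightarrow> bool" where
  "quadratic_form Q \<longleftrightarrow>
     (\<exists>c :: 'n \<Rightarrow> 'n \<Rightarrow> rat. \<forall>x. Q x = (\<Sum>i\<in>UNIV. \<Sum>j\<in>UNIV. c i j * x $ i * x $ j))"

definition matrix_of_form :: "(rat ^ 'n \<Rightarrow> rat) \<Rightarrow> rat ^ 'n ^ 'n \<Rightarrow> bool" where
  "matrix_of_form Q A \<longleftrightarrow>
     transpose A = A \<and> (\<forall>x. Q x = (\<Sum>i\<in>UNIV. x $ i * (A *v x) $ i))"

text \<open>A form on \<open>rat ^ 'n\<close> is a form in fewer than \<open>CARD('n)\<close> variables if some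
  coordinate does not occur in it. Over the infinite field of rationals this can be
  read off from its values.\<close>

definition in_fewer_variables :: "(rat ^ 'n \<Rightarrow> rat) \<Rightarrow> bool" where
  "in_fewer_variables Q \<longleftrightarrow>
     (\<exists>k. \<forall>x y. (\<forall>i. i \<noteq> k \<longrightarrow> x $ i = y $ i) \<longrightarrow> Q x = Q y)"

definition in_independent_variables :: "(rat ^ 'n \<Rightarrow> rat) \<Rightarrow> bool" where
  "in_independent_variables Q \<longleftrightarrow>
     \<not> (\<exists>P :: rat ^ 'n ^ 'n. invertible P \<and> in_fewer_variables (\<lambda>y. Q (P *v y)))"

definition bilinear_form :: "(rat \<Rightarrow> rat \<Rightarrow> rat \<Rightarrow> rat \<Rightarrow> rat) \<Rightarrow> bool" where
  "bilinear_form B \<longleftrightarrow>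
     (\<exists>a b c d. \<forall>p q r s. B p q r s = a * (p * r) + b * (p * s) + c * (q * r) + d * (q * s))"

text \<open>Solutions count up to a nonzero rational factor, whence \<open>k\<close>.\<close>

definition complete_solution_by_bilinear_forms :: "(rat ^ 'n \<Rightarrow> rat) \<Rightarrow> bool" where
  "complete_solution_by_bilinear_forms Q \<longleftrightarrow>
     (\<exists>B :: 'n \<Rightarrow> rat \<Rightarrow> rat \<Rightarrow> rat \<Rightarrow> rat \<Rightarrow> rat.
        (\<forall>i. bilinear_form (B i)) \<and>
        (\<forall>p q r s. Q (\<chi> i. B i p q r s) = 0) \<and>
        (\<forall>x. Q x = 0 \<longrightarrow> (\<exists>p q r s k. k \<noteq> 0 \<and> x = k *s (\<chi> i. B i p q r s))))"

end

theory Submission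
  imports Defs
begin

text \<open>
  A parametrization by bilinear forms is a linear image of the Segre map
  \<open>(p, q; r, s) \<mapsto> (p r, q s, p s, q r)\<close>, whose values are exactly the solutions of
  \<open>z\<^sub>1 z\<^sub>2 = z\<^sub>3 z\<^sub>4\<close>. So the question is whether \<open>Q\<close> becomes \<open>z\<^sub>1 z\<^sub>2 - z\<^sub>3 z\<^sub>4\<close>, up to a
  factor, after a rational change of variables. The matrix of \<open>z\<^sub>1 z\<^sub>2 - z\<^sub>3 z\<^sub>4\<close> has a square
  determinant, and a change of variables multiplies the determinant of a form by a nonzero square;
  hence the condition on \<open>det A\<close>.

  If \<open>det A\<close> is a nonzero square, a nontrivial zero \<open>u\<close> has a partner \<open>v\<close> that spans a
  hyperbolic plane with it (\<open>hyperbolic_partner\<close>). In a basis that begins with \<open>u, v\<close>,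
  completing the product turns \<open>Q\<close> into \<open>2 y\<^sub>1 y\<^sub>2\<close> plus a binary form in \<open>y\<^sub>3, y\<^sub>4\<close>. The
  hyperbolic plane contributes \<open>-1\<close> to the determinant, so minus the determinant of the binary form
  is a nonzero square, and that is what makes it a product of two independent rational linear forms
  (\<open>binary_form_factors\<close>, \<open>split_form_if_square_det\<close>).

  Conversely, let the bilinear forms have coefficient matrix \<open>M\<close>, so that the solutions are
  \<open>M z\<close> with \<open>z\<close> in the image of the Segre map. The form with Gram matrix \<open>M\<^sup>T A M\<close>
  vanishes on that image, and only the multiples of \<open>z\<^sub>1 z\<^sub>2 - z\<^sub>3 z\<^sub>4\<close> do, so
  \<open>det A (det M)\<^sup>2\<close> is a square. It remains to see that \<open>M\<close> is invertible. Here completeness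
  enters: the column space of \<open>M\<close> contains all zeros of \<open>Q\<close>, and these span the whole space as soon
  as one of them is nontrivial (\<open>isotropic_vectors_span\<close>).
\<close>

section \<open>The bilinear form of a matrix\<close>

definition bil :: "'a::field ^ 'n ^ 'n \<Rightarrow> 'a ^ 'n \<Rightarrow> 'a ^ 'n \<Rightarrow> 'a" where
  "bil A x y = (\<Sum>i\<in>UNIV. x $ i * (A *v y) $ i)"

lemma bil_add_left: "bil A (x + y) z = bil A x z + bil A y z"
  by (simp add: bil_def distrib_right sum.distrib)

lemma bil_add_right: "bil A x (y + z) = bil A x y + bil A x z"
  by (simp add: bil_def matrix_vector_right_distrib distrib_left sum.distrib)

lemma bil_scale_left: "bil A (k *s x) y = k * bil A x y"
  by (simp add: bil_def sum_distrib_left mult.assoc)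

lemma bil_scale_right: "bil A x (k *s y) = k * bil A x y"
  by (simp add: bil_def vector_scalar_commute sum_distrib_left mult.left_commute)

lemmas bil_linear = bil_add_left bil_add_right bil_scale_left bil_scale_right

lemma bil_commute:
  assumes "transpose A = A"
  shows "bil A x y = bil A y x"
proof -
  have A: "A $ i $ j = A $ j $ i" for i j
    by (metis assms transpose_def vec_lambda_beta)
  have "bil A x y = (\<Sum>i\<in>UNIV. \<Sum>j\<in>UNIV. x $ i * (A $ i $ j * y $ j))"
    by (simp add: bil_def matrix_vector_mult_def sum_distrib_left)
  also have "\<dots> = (\<Sum>j\<in>UNIV. \<Sum>i\<in>UNIV. x $ i * (A $ i $ j * y $ j))"
    by (rule sum.swap)
  also have "\<dots> = (\<Sum>j\<in>UNIV. \<Sum>i\<in>UNIV. y $ j * (A $ j $ i * x $ i))"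
    by (intro sum.cong refl) (metis A mult.commute mult.left_commute)
  also have "\<dots> = bil A y x"
    by (simp add: bil_def matrix_vector_mult_def sum_distrib_left)
  finally show ?thesis .
qed

lemma bil_change_of_variables:
  "bil A (P *v x) (P *v y) = bil (transpose P ** A ** P) x y"
proof -
  have adj: "(\<Sum>i\<in>UNIV. (P *v x) $ i * w $ i) = (\<Sum>j\<in>UNIV. x $ j * (transpose P *v w) $ j)" for w
  proof -
    have "(\<Sum>i\<in>UNIV. (P *v x) $ i * w $ i) = (\<Sum>i\<in>UNIV. \<Sum>j\<in>UNIV. P $ i $ j * x $ j * w $ i)"
      by (simp add: matrix_vector_mult_def sum_distrib_right)
    also have "\<dots> = (\<Sum>j\<in>UNIV. \<Sum>i\<in>UNIV. P $ i $ j * x $ j * w $ i)"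
      by (rule sum.swap)
    also have "\<dots> = (\<Sum>j\<in>UNIV. x $ j * (transpose P *v w) $ j)"
      by (simp add: matrix_vector_mult_def transpose_def sum_distrib_left ac_simps)
    finally show ?thesis .
  qed
  show ?thesis
    unfolding bil_def adj by (simp add: matrix_vector_mul_assoc matrix_mul_assoc)
qed

lemma bil_axis_left: "bil A (axis i 1) y = (A *v y) $ i"
proof -
  have "bil A (axis i 1) y = (\<Sum>k\<in>UNIV. if k = i then (A *v y) $ k else 0)"
    unfolding bil_def by (intro sum.cong) (auto simp: axis_def)
  then show ?thesis by simp
qed

lemma matrix_mult_axis: "(P :: 'a::field ^ 'n ^ 'm) *v axis j 1 = column j P"
proof -
  have "P $ i $ k * axis j 1 $ k = (if k = j then P $ i $ k else 0)" for i k
    by (simp add: axis_def)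
  then show ?thesis
    by (simp add: matrix_vector_mult_def column_def vec_eq_iff)
qed

lemma gram_matrix_entry:
  "(transpose P ** A ** P) $ i $ j = bil A (column i P) (column j P)"
proof -
  have "bil A (column i P) (column j P) = bil A (P *v axis i 1) (P *v axis j 1)"
    by (simp add: matrix_mult_axis)
  also have "\<dots> = (transpose P ** A ** P) $ i $ j"
    unfolding bil_change_of_variables bil_axis_left
    by (simp add: matrix_mult_axis column_def)
  finally show ?thesis by simp
qed

lemma bil_nondegenerate:
  fixes A :: "'a::field ^ 'n ^ 'n"
  assumes "det A \<noteq> 0" "u \<noteq> 0"
  obtains w where "bil A w u \<noteq> 0"
proof -
  have "A *v u \<noteq> 0"
    using assms invertible_det_nz invertible_left_inverse matrix_left_invertible_ker by metis
  then obtain i where "(A *v u) $ i \<noteq> 0"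
    by (auto simp: vec_eq_iff)
  then show ?thesis using that bil_axis_left by metis
qed

section \<open>Changes of variables and determinants\<close>

text \<open>Extension of an independent family to a basis, in matrix form. The family stays indexed, so that
  each of its vectors lands in a prescribed column of the change of variables.\<close>

lemma invertible_matrix_with_columns:
  fixes g :: "'n \<Rightarrow> 'a::field ^ 'n"
  assumes "inj_on g K" "vec.independent (g ` K)"
  obtains P :: "'a ^ 'n ^ 'n" where "invertible P" "\<And>k. k \<in> K \<Longrightarrow> column k P = g k"
proof -
  define S where "S = vec.extend_basis (g ` K)"
  have S: "g ` K \<subseteq> S" "vec.independent S" "vec.span S = UNIV"
    using assms(2) vec.extend_basis_superset vec.independent_extend_basis vec.span_extend_basis
    unfolding S_def by auto
  have fin: "finite S" using S(2) by (rule vec.finiteI_independent)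
  have card_S: "card S = CARD('n)"
    using vec.basis_card_eq_dim[of S UNIV] S vec_dim_card by auto
  have "card (S - g ` K) = card (- K)"
    using S(1) fin card_S assms(1)
    by (simp add: card_Diff_subset finite_subset card_image Compl_eq_Diff_UNIV)
  then obtain h where h: "bij_betw h (- K) (S - g ` K)"
    using fin by (metis finite_Diff finite finite_same_card_bij)
  define f where "f k = (if k \<in> K then g k else h k)" for k
  have "bij_betw f (K \<union> - K) (g ` K \<union> (S - g ` K))"
  proof (rule bij_betw_combine)
    show "bij_betw f K (g ` K)"
      using assms(1) by (auto simp: bij_betw_def f_def inj_on_def)
    show "bij_betw f (- K) (S - g ` K)"
      using h by (subst bij_betw_cong[of _ _ h]) (auto simp: f_def)
  qed auto
  then have f: "range f = S"
    using S(1) by (simp add: bij_betw_def Un_absorb1)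
  define P :: "'a ^ 'n ^ 'n" where "P = (\<chi> i j. f j $ i)"
  have col: "column k P = f k" for k
    by (simp add: P_def column_def vec_eq_iff)
  have "columns P = S"
    using f by (auto simp: columns_def col)
  then have "invertible P"
    using S(3) matrix_right_invertible_span_columns[of P] invertible_right_inverse by blast
  then show ?thesis
    using that col by (simp add: f_def)
qed

lemma vector_4 [simp]:
  "(vector [w, x, y, z] :: 'a::zero ^ 4) $ 1 = w"
  "(vector [w, x, y, z] :: 'a ^ 4) $ 2 = x"
  "(vector [w, x, y, z] :: 'a ^ 4) $ 3 = y"
  "(vector [w, x, y, z] :: 'a ^ 4) $ 4 = z"
  unfolding vector_def by simp_all

lemma det_4:
  "det (A :: 'a::comm_ring_1 ^ 4 ^ 4) =
     A$1$1 * (A$2$2 * A$3$3 * A$4$4 + A$2$3 * A$3$4 * A$4$2 + A$2$4 * A$3$2 * A$4$3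
            - A$2$2 * A$3$4 * A$4$3 - A$2$3 * A$3$2 * A$4$4 - A$2$4 * A$3$3 * A$4$2)
   - A$1$2 * (A$2$1 * A$3$3 * A$4$4 + A$2$3 * A$3$4 * A$4$1 + A$2$4 * A$3$1 * A$4$3
            - A$2$1 * A$3$4 * A$4$3 - A$2$3 * A$3$1 * A$4$4 - A$2$4 * A$3$3 * A$4$1)
   + A$1$3 * (A$2$1 * A$3$2 * A$4$4 + A$2$2 * A$3$4 * A$4$1 + A$2$4 * A$3$1 * A$4$2
            - A$2$1 * A$3$4 * A$4$2 - A$2$2 * A$3$1 * A$4$4 - A$2$4 * A$3$2 * A$4$1)
   - A$1$4 * (A$2$1 * A$3$2 * A$4$3 + A$2$2 * A$3$3 * A$4$1 + A$2$3 * A$3$1 * A$4$2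
            - A$2$1 * A$3$3 * A$4$2 - A$2$2 * A$3$1 * A$4$3 - A$2$3 * A$3$2 * A$4$1)"
proof -
  have f1: "finite {2::4, 3, 4}" "1 \<notin> {2::4, 3, 4}" by auto
  have f2: "finite {3::4, 4}" "2 \<notin> {3::4, 4}" by auto
  have f3: "finite {4::4}" "3 \<notin> {4::4}" by auto
  show ?thesis
    unfolding det_def UNIV_4
    unfolding sum_over_permutations_insert[OF f1]
    unfolding sum_over_permutations_insert[OF f2]
    unfolding sum_over_permutations_insert[OF f3]
    unfolding permutes_sing
    by (simp add: sign_swap_id sign_compose permutation_compose permutation_swap_id sign_id
      transpose_apply_other algebra_simps)
qed

text \<open>A nonzero kernel vector \<open>v\<close> of \<open>A\<close> can be made a new coordinate axis. Moving along
  \<open>v\<close> does not change \<open>Q\<close>, so this coordinate does not occur in the transformed form.\<close>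

lemma det_nonzero_if_independent_variables:
  fixes Q :: "rat ^ 'n \<Rightarrow> rat"
  assumes "in_independent_variables Q" and Q: "\<And>x. Q x = bil A x x" and sym: "transpose A = A"
  shows "det A \<noteq> 0"
proof
  assume "det A = 0"
  then obtain v where v: "v \<noteq> 0" "A *v v = 0"
    using invertible_det_nz invertible_left_inverse matrix_left_invertible_ker by metis
  \<comment> \<open>Any coordinate can be the one that disappears.\<close>
  obtain k :: 'n where True by simp
  obtain P :: "rat ^ 'n ^ 'n" where P: "invertible P" "column k P = v"
    using invertible_matrix_with_columns[of "\<lambda>_. v" "{k}"] v(1) by auto
  have "Q (P *v x) = Q (P *v y)" if "\<forall>i. i \<noteq> k \<longrightarrow> x $ i = y $ i" for x y
  proof -
    define t where "t = x $ k - y $ k"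
    have "x = y + t *s axis k 1"
      using that by (auto simp: vec_eq_iff t_def axis_def)
    then have "P *v x = P *v y + t *s v"
      using P(2) by (simp add: matrix_vector_right_distrib vector_scalar_commute matrix_mult_axis)
    moreover have right: "bil A w v = 0" for w
      using v(2) by (simp add: bil_def)
    moreover have "bil A v w = 0" for w
      using right bil_commute[OF sym] by metis
    ultimately show ?thesis
      by (simp add: Q bil_linear)
  qed
  then show False
    using assms(1) P(1) unfolding in_independent_variables_def in_fewer_variables_def by blast
qed


section \<open>Zeros of a nondegenerate form\<close>

text \<open>On a line \<open>w + t u\<close> through a zero \<open>u\<close> at infinity the form is affine in \<open>t\<close>, with slope
  \<open>2 bil A w u\<close>. Hence every \<open>w\<close> that is not orthogonal to \<open>u\<close> differs from a zero of the form by a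
  multiple of \<open>u\<close>. The remaining vectors are differences of two vectors not orthogonal to \<open>u\<close>.\<close>

lemma isotropic_vectors_span:
  fixes A :: "'a::field_char_0 ^ 'n ^ 'n"
  assumes sym: "transpose A = A" and "det A \<noteq> 0" and u: "u \<noteq> 0" "bil A u u = 0"
  shows "vec.span {x. bil A x x = 0} = UNIV"
proof -
  let ?I = "{x. bil A x x = 0}"
  obtain w0 where w0: "bil A w0 u \<noteq> 0"
    using bil_nondegenerate assms by metis
  have generic: "w \<in> vec.span ?I" if "bil A w u \<noteq> 0" for w
  proof -
    define t where "t = - bil A w w / (2 * bil A w u)"
    have "bil A (w + t *s u) (w + t *s u) = bil A w w + 2 * t * bil A w u"
      using u(2) bil_commute[OF sym, of u w] by (simp add: bil_linear)
    also have "\<dots> = 0"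
      using that by (simp add: t_def)
    finally have "w + t *s u \<in> vec.span ?I"
      by (auto intro: vec.span_base)
    moreover have "t *s u \<in> vec.span ?I"
      using u(2) by (auto intro: vec.span_base vec.span_scale)
    ultimately show ?thesis
      using vec.span_diff by fastforce
  qed
  have "w \<in> vec.span ?I" for w
  proof (cases "bil A w u = 0")
    case True
    then have "w + w0 \<in> vec.span ?I" "w0 \<in> vec.span ?I"
      using w0 by (auto intro!: generic simp: bil_linear)
    then show ?thesis
      using vec.span_diff by fastforce
  qed (rule generic)
  then show ?thesis by blast
qed

text \<open>Any \<open>w\<close> not orthogonal to \<open>u\<close> can be moved along \<open>u\<close> to a zero of the form and then
  rescaled.\<close>

lemma hyperbolic_partner:
  fixes A :: "'a::field_char_0 ^ 'n ^ 'n"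
  assumes sym: "transpose A = A" and "det A \<noteq> 0" and u: "u \<noteq> 0" "bil A u u = 0"
  obtains v where "bil A v v = 0" "bil A u v = 1"
proof -
  obtain w where w: "bil A w u \<noteq> 0"
    using isotropic_vectors_span[OF assms] bil_nondegenerate assms by metis
  have uw: "bil A u w \<noteq> 0" "bil A w u = bil A u w"
    using w bil_commute[OF sym] by simp_all
  define t where "t = - bil A w w / (2 * bil A u w)"
  define v where "v = (1 / bil A u w) *s (w + t *s u)"
  have "bil A v v = (bil A w w + 2 * t * bil A u w) / (bil A u w)\<^sup>2"
    using u(2) uw by (simp add: v_def bil_linear power2_eq_square field_simps)
  moreover have "bil A u v = 1"
    using u(2) uw by (simp add: v_def bil_linear)
  ultimately show ?thesis
    using that[of v] uw by (simp add: t_def)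
qed

section \<open>A square determinant splits the form\<close>

text \<open>For \<open>a \<noteq> 0\<close> this is the difference of squares \<open>(a x + b y)\<^sup>2 - (e y)\<^sup>2\<close>, divided by \<open>a\<close>.
  The two factors are independent because \<open>e \<noteq> 0\<close>.\<close>

lemma binary_form_factors:
  fixes a b c e :: "'a::field_char_0"
  assumes "b\<^sup>2 - a * c = e\<^sup>2" "e \<noteq> 0"
  obtains k l m n where "k * n - l * m \<noteq> 0"
    "\<And>x y. a * x\<^sup>2 + 2 * b * x * y + c * y\<^sup>2 = (k * x + l * y) * (m * x + n * y)"
proof (cases "a = 0")
  case True
  then have "b \<noteq> 0" using assms by auto
  then show ?thesis
    using True by (intro that[where k = 0 and l = 1 and m = "2 * b" and n = c]) (simp_all add: algebra_simps power2_eq_square)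
next
  case False
  show ?thesis
  proof (rule that[where k = a and l = "b - e" and m = 1 and n = "(b + e) / a"])
    show "a * ((b + e) / a) - (b - e) * 1 \<noteq> 0"
      using assms(2) False by simp
    fix x y
    have c: "c = (b - e) * (b + e) / a"
      using assms(1) False by (simp add: field_simps power2_eq_square)
    show "a * x\<^sup>2 + 2 * b * x * y + c * y\<^sup>2 = (a * x + (b - e) * y) * (1 * x + (b + e) / a * y)"
      unfolding c using False by (simp add: field_simps power2_eq_square)
  qed
qed

text \<open>The change of variables has two stages: \<open>P\<close> puts a hyperbolic pair into the first two
  coordinates, and \<open>N\<close> collects the linear factors that remain after completing the product.\<close>

lemma split_form_if_square_det:
  fixes A :: "'a::field_char_0 ^ 4 ^ 4"
  assumes sym: "transpose A = A" and det: "det A = d\<^sup>2" "d \<noteq> 0"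
    and u: "u \<noteq> 0" "bil A u u = 0"
  obtains T :: "'a ^ 4 ^ 4" where "invertible T"
    "\<And>x. bil A x x = (T *v x) $ 1 * (T *v x) $ 2 - (T *v x) $ 3 * (T *v x) $ 4"
proof -
  have "det A \<noteq> 0" using det by simp
  then obtain v where v: "bil A v v = 0" "bil A u v = 1"
    using hyperbolic_partner sym u by metis
  have indep: "vec.independent {v, u}"
  proof -
    have "v \<notin> vec.span {u}"
      using v u(2) by (auto simp: vec.span_singleton bil_linear)
    then show ?thesis
      using u(1) by (simp add: vec.independent_insert)
  qed
  obtain P :: "'a ^ 4 ^ 4" where P: "invertible P" "column 1 P = u" "column 2 P = v"
  proof (rule invertible_matrix_with_columns[of "\<lambda>k. if k = 1 then u else v" "{1, 2 :: 4}"])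
    show "inj_on (\<lambda>k. if k = 1 then u else v) {1, 2 :: 4}"
      using v u(2) by (auto simp: inj_on_def)
  qed (use indep that in \<open>auto simp: insert_commute\<close>)
  define G where "G = transpose P ** A ** P"
  have G_sym: "G $ i $ j = G $ j $ i" for i j
    unfolding G_def gram_matrix_entry by (rule bil_commute[OF sym])
  have G_known: "G $ 1 $ 1 = 0" "G $ 2 $ 2 = 0" "G $ 1 $ 2 = 1"
    using u v by (simp_all add: G_def gram_matrix_entry P)
  \<comment> \<open>The coefficients in \<open>y\<^sub>3, y\<^sub>4\<close> left after subtracting
    \<open>2 (y\<^sub>1 + G\<^sub>2\<^sub>3 y\<^sub>3 + G\<^sub>2\<^sub>4 y\<^sub>4) (y\<^sub>2 + G\<^sub>1\<^sub>3 y\<^sub>3 + G\<^sub>1\<^sub>4 y\<^sub>4)\<close>, that is, the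
    form on the orthogonal complement of the hyperbolic plane.\<close>
  define a where "a = G $ 3 $ 3 - 2 * G $ 1 $ 3 * G $ 2 $ 3"
  define b where "b = G $ 3 $ 4 - G $ 1 $ 3 * G $ 2 $ 4 - G $ 1 $ 4 * G $ 2 $ 3"
  define c where "c = G $ 4 $ 4 - 2 * G $ 1 $ 4 * G $ 2 $ 4"
  have det_P: "det P \<noteq> 0"
    using P(1) invertible_det_nz by blast
  have "det G = (d * det P)\<^sup>2"
    by (simp add: G_def det_mul det(1) power2_eq_square)
  moreover have "det G = b\<^sup>2 - a * c"
    unfolding det_4 a_def b_def c_def
    by (simp add: G_known G_sym[of 2 1] G_sym[of 3 1] G_sym[of 4 1] G_sym[of 3 2] G_sym[of 4 2] G_sym[of 4 3])
       (simp add: algebra_simps power2_eq_square)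
  ultimately obtain k l m n where kl: "k * n - l * m \<noteq> 0"
    and fac: "\<And>x y. a * x\<^sup>2 + 2 * b * x * y + c * y\<^sup>2 = (k * x + l * y) * (m * x + n * y)"
    using binary_form_factors[of b a c "d * det P"] det(2) det_P by (metis mult_eq_0_iff)
  \<comment> \<open>The third row carries a minus sign because the target is \<open>z\<^sub>1 z\<^sub>2 - z\<^sub>3 z\<^sub>4\<close>.\<close>
  define N :: "'a ^ 4 ^ 4" where
    "N = vector [vector [2, 0, 2 * G $ 2 $ 3, 2 * G $ 2 $ 4], vector [0, 1, G $ 1 $ 3, G $ 1 $ 4],
       vector [0, 0, - k, - l], vector [0, 0, m, n]]"
  have "det N = 2 * (l * m - k * n)"
    unfolding det_4 N_def by (simp add: algebra_simps)
  then have N: "invertible N"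
    using kl by (simp add: invertible_det_nz)
  obtain P' where P': "P ** P' = mat 1" "P' ** P = mat 1"
    using P(1) by (auto simp: invertible_def)
  show ?thesis
  proof (rule that[of "N ** P'"])
    show "invertible (N ** P')"
      using N P' by (metis invertible_def invertible_mult)
    fix x
    define y where "y = P' *v x"
    have x: "x = P *v y"
      by (simp add: y_def matrix_vector_mul_assoc P')
    have "bil A x x = bil G y y"
      by (simp add: x bil_change_of_variables G_def)
    also have "\<dots> = 2 * (y $ 1 + G $ 2 $ 3 * y $ 3 + G $ 2 $ 4 * y $ 4) *
        (y $ 2 + G $ 1 $ 3 * y $ 3 + G $ 1 $ 4 * y $ 4) +
        (a * (y $ 3)\<^sup>2 + 2 * b * y $ 3 * y $ 4 + c * (y $ 4)\<^sup>2)"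
      unfolding bil_def matrix_vector_mult_def sum_4 vec_lambda_beta a_def b_def c_def
      by (simp add: G_known G_sym[of 2 1] G_sym[of 3 1] G_sym[of 4 1] G_sym[of 3 2] G_sym[of 4 2] G_sym[of 4 3])
         (simp add: algebra_simps power2_eq_square)
    also have "\<dots> = (N *v y) $ 1 * (N *v y) $ 2 - (N *v y) $ 3 * (N *v y) $ 4"
      unfolding fac by (simp add: N_def matrix_vector_mult_def sum_4 algebra_simps)
    also have "N *v y = (N ** P') *v x"
      by (simp add: y_def matrix_vector_mul_assoc)
    finally show "bil A x x = ((N ** P') *v x) $ 1 * ((N ** P') *v x) $ 2
        - ((N ** P') *v x) $ 3 * ((N ** P') *v x) $ 4" .
  qed
qed

section \<open>Parametrization by bilinear forms\<close>

text \<open>This is the equality of ratios \<open>p : q = z\<^sub>1 : z\<^sub>4\<close> and \<open>r : s = z\<^sub>1 : z\<^sub>3\<close>, with the points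
  where these are undefined treated apart.\<close>

lemma segre_parametrization:
  fixes z1 z2 z3 z4 :: "'a::field"
  assumes "z1 * z2 = z3 * z4"
  obtains p q r s where "z1 = p * r" "z2 = q * s" "z3 = p * s" "z4 = q * r"
proof (cases "z1 = 0")
  case False
  then show ?thesis
    using assms by (intro that[where p = 1 and q = "z4 / z1" and r = z1 and s = z3]) (auto simp: field_simps)
next
  case True
  then have "z3 = 0 \<or> z4 = 0" using assms by simp
  then show ?thesis
    using True that[where p = 0 and q = 1 and r = z4 and s = z2] that[where p = z3 and q = z2 and r = 0 and s = 1] by auto
qed

lemma complete_solution_if_split:
  fixes Q :: "rat ^ 4 \<Rightarrow> rat" and T :: "rat ^ 4 ^ 4"
  assumes T: "invertible T"
    and Q: "\<And>x. Q x = (T *v x) $ 1 * (T *v x) $ 2 - (T *v x) $ 3 * (T *v x) $ 4"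
  shows "complete_solution_by_bilinear_forms Q"
proof -
  obtain S where S: "S ** T = mat 1" "T ** S = mat 1"
    using T by (auto simp: invertible_def)
  define z :: "rat \<Rightarrow> rat \<Rightarrow> rat \<Rightarrow> rat \<Rightarrow> rat ^ 4" where
    "z p q r s = vector [p * r, q * s, p * s, q * r]" for p q r s
  define B where "B i p q r s = (S *v z p q r s) $ i" for i p q r s
  have B: "(\<chi> i. B i p q r s) = S *v z p q r s" for p q r s
    by (simp add: B_def vec_eq_iff)
  have "bilinear_form (B i)" for i
    unfolding bilinear_form_def B_def z_def matrix_vector_mult_def
    by (rule exI[of _ "S $ i $ 1"], rule exI[of _ "S $ i $ 3"],
        rule exI[of _ "S $ i $ 4"], rule exI[of _ "S $ i $ 2"]) (simp add: sum_4)
  moreover have "Q (\<chi> i. B i p q r s) = 0" for p q r s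
    unfolding B Q by (simp add: matrix_vector_mul_assoc S z_def)
  moreover have "\<exists>p q r s k. k \<noteq> 0 \<and> x = k *s (\<chi> i. B i p q r s)" if "Q x = 0" for x
  proof -
    have "(T *v x) $ 1 * (T *v x) $ 2 = (T *v x) $ 3 * (T *v x) $ 4"
      using that by (simp add: Q)
    then obtain p q r s where "(T *v x) $ 1 = p * r" "(T *v x) $ 2 = q * s"
      "(T *v x) $ 3 = p * s" "(T *v x) $ 4 = q * r"
      by (rule segre_parametrization)
    then have "T *v x = z p q r s"
      by (simp add: vec_eq_iff forall_4 z_def)
    then have "x = 1 *s (\<chi> i. B i p q r s)"
      unfolding B by (metis S(1) matrix_vector_mul_assoc matrix_vector_mul_lid vector_smult_lid)
    then show ?thesis by (metis one_neq_zero)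
  qed
  ultimately show ?thesis
    unfolding complete_solution_by_bilinear_forms_def by blast
qed

text \<open>The column space of the coefficient matrix \<open>M\<close> contains all zeros of \<open>Q\<close>, hence is
  everything. On the other hand the Segre image lies on no quadrics but the multiples of
  \<open>z\<^sub>1 z\<^sub>2 - z\<^sub>3 z\<^sub>4\<close>, which leaves a single free entry in the Gram matrix \<open>M\<^sup>T A M\<close>.\<close>

lemma square_det_if_complete_solution:
  fixes Q :: "rat ^ 4 \<Rightarrow> rat"
  assumes "complete_solution_by_bilinear_forms Q"
    and Q: "\<And>x. Q x = bil A x x" and sym: "transpose A = A"
    and det: "det A \<noteq> 0" and u: "u \<noteq> 0" "Q u = 0"
  shows "is_square (det A)"
proof -
  obtain B where B: "\<And>i. bilinear_form (B i)"
    and sol: "\<And>p q r s. Q (\<chi> i. B i p q r s) = 0"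
    and complete: "\<And>x. Q x = 0 \<Longrightarrow> \<exists>p q r s k. k \<noteq> 0 \<and> x = k *s (\<chi> i. B i p q r s)"
    using assms(1) unfolding complete_solution_by_bilinear_forms_def by blast
  obtain a b c d where abcd:
    "\<And>i p q r s. B i p q r s = a i * (p * r) + b i * (p * s) + c i * (q * r) + d i * (q * s)"
    using B unfolding bilinear_form_def by metis
  \<comment> \<open>The columns are ordered so that the Segre relation reads \<open>z\<^sub>1 z\<^sub>2 = z\<^sub>3 z\<^sub>4\<close>.\<close>
  define M :: "rat ^ 4 ^ 4" where "M = (\<chi> i. vector [a i, d i, b i, c i])"
  define z :: "rat \<Rightarrow> rat \<Rightarrow> rat \<Rightarrow> rat \<Rightarrow> rat ^ 4" where
    "z p q r s = vector [p * r, q * s, p * s, q * r]" for p q r s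
  have BM: "(\<chi> i. B i p q r s) = M *v z p q r s" for p q r s
    by (simp add: abcd M_def z_def matrix_vector_mult_def sum_4 vec_eq_iff)
  have "range ((*v) M) = vec.span (range ((*v) M))"
    by (simp add: vec.span_image)
  moreover have "{x. bil A x x = 0} \<subseteq> range ((*v) M)"
    using complete unfolding Q BM by (auto simp: image_iff) (metis vector_scalar_commute)
  ultimately have "vec.span {x. bil A x x = 0} \<subseteq> range ((*v) M)"
    using vec.span_mono by blast
  then have "surj ((*v) M)"
    using isotropic_vectors_span[OF sym det u(1)] u(2) Q by auto
  then have det_M: "det M \<noteq> 0"
    using matrix_right_invertible_surjective invertible_right_inverse invertible_det_nz by metis
  define G where "G = transpose M ** A ** M"
  have G_sym: "G $ i $ j = G $ j $ i" for i j
    unfolding G_def gram_matrix_entry by (rule bil_commute[OF sym])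
  have G_zero: "bil G (z p q r s) (z p q r s) = 0" for p q r s
    using sol[of p q r s] by (simp add: BM Q bil_change_of_variables G_def)
  note G_simps = bil_def matrix_vector_mult_def sum_4 z_def
    G_sym[of 2 1] G_sym[of 3 1] G_sym[of 4 1] G_sym[of 3 2] G_sym[of 4 2] G_sym[of 4 3]
  \<comment> \<open>Each entry is read off at a parameter point where every other entry is absent or already known:
    one nonzero coordinate for the diagonal, two for the next four entries. The point
    \<open>(1, 1, 1, 1)\<close> then relates the two entries that are left.\<close>
  have diag: "G $ 1 $ 1 = 0" "G $ 2 $ 2 = 0" "G $ 3 $ 3 = 0" "G $ 4 $ 4 = 0"
    using G_zero[of 1 0 1 0] G_zero[of 0 1 0 1] G_zero[of 1 0 0 1] G_zero[of 0 1 1 0]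
    by (simp_all add: G_simps)
  have off: "G $ 1 $ 3 = 0" "G $ 1 $ 4 = 0" "G $ 2 $ 3 = 0" "G $ 2 $ 4 = 0"
    using G_zero[of 1 0 1 1] G_zero[of 1 1 1 0] G_zero[of 1 1 0 1] G_zero[of 0 1 1 1]
    by (simp_all add: G_simps diag)
  have "G $ 3 $ 4 = - G $ 1 $ 2"
    using G_zero[of 1 1 1 1] by (simp add: G_simps diag off)
  then have "det G = ((G $ 1 $ 2)\<^sup>2)\<^sup>2"
    unfolding det_4 by (simp add: G_simps diag off power2_eq_square)
  moreover have "det G = det A * (det M)\<^sup>2"
    by (simp add: G_def det_mul power2_eq_square)
  ultimately have "det A = ((G $ 1 $ 2)\<^sup>2 / det M)\<^sup>2"
    using det_M by (simp add: power_divide eq_divide_eq)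
  then show ?thesis by (metis is_nth_powerI)
qed

theorem theorem2:
  fixes Q :: "rat ^ 4 \<Rightarrow> rat" and A :: "rat ^ 4 ^ 4"
  assumes "quadratic_form Q"
    and "in_independent_variables Q"
    and "matrix_of_form Q A"
    and "\<exists>x :: int ^ 4. x \<noteq> 0 \<and> Q (\<chi> i. of_int (x $ i)) = 0"
  shows "complete_solution_by_bilinear_forms Q \<longleftrightarrow> det A \<noteq> 0 \<and> is_square (det A)"
proof -
  have sym: "transpose A = A" and Q: "\<And>x. Q x = bil A x x"
    using assms(3) by (auto simp: matrix_of_form_def bil_def)
  have det: "det A \<noteq> 0"
    using det_nonzero_if_independent_variables assms(2) Q sym by blast
  obtain u :: "rat ^ 4" where u: "u \<noteq> 0" "Q u = 0"
  proof -
    from assms(4) obtain x :: "int ^ 4" where "x \<noteq> 0" "Q (\<chi> i. of_int (x $ i)) = 0"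
      by blast
    moreover from this(1) have "(\<chi> i. of_int (x $ i)) \<noteq> (0 :: rat ^ 4)"
      by (auto simp: vec_eq_iff)
    ultimately show ?thesis using that by blast
  qed
  show ?thesis
  proof
    assume "complete_solution_by_bilinear_forms Q"
    then show "det A \<noteq> 0 \<and> is_square (det A)"
      using square_det_if_complete_solution Q sym det u by blast
  next
    assume "det A \<noteq> 0 \<and> is_square (det A)"
    then obtain d where d: "det A = d\<^sup>2" "d \<noteq> 0"
      by (auto elim!: is_nth_powerE)
    then obtain T :: "rat ^ 4 ^ 4" where "invertible T"
      "\<And>x. bil A x x = (T *v x) $ 1 * (T *v x) $ 2 - (T *v x) $ 3 * (T *v x) $ 4"
      using split_form_if_square_det[OF sym d u(1)] u(2) Q by metis
    then show "complete_solution_by_bilinear_forms Q"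
      using complete_solution_if_split Q by simp
  qed
qed

end
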